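(* Let $D\in\mathbb{N}$, $E_0,\ldots,E_D\in\mathbb{R}$ and $\beta\in\mathbb{R}$. As $N\to\infty$, the measures $\mu_N$, viewed as measures on $\mathbb{X}$, converge weakly to $P_\infty$ in the product topology on $\mathbb{X}$.
   Context: $\mathbb{N}=\{1,2,\ldots\}$. A plane tree (ordered tree) is a rooted tree in which the child subtrees of every vertex are linearly ordered (trees are considered up to isomorphism preserving the root and these orders). The branching number $\deg(v)$ of a vertex $v$ is its number of children; the height of $v$ is its distance to the root; the height of a finite tree is the maximal height of its vertices. $\mathbb{T}_N$ is the set of all plane trees on $N$ vertices with all branching numbers at most $D$. For a finite tree $T$ with vertex set $V(T)$, $E(T)=\sum_{v\in V(T)}E_{\deg(v)}$. The probability measure $\mu_N$ on $\mathbb{T}_N$ is $\mu_N\{T\}=e^{-\beta E(T)}/Z_N$, $Z_N=\sum_{T\in\mathbb{T}_N}e^{-\beta E(T)}$. For $T\in\mathbb{T}_N$, $\pi_{n,N}T$ is the subtree spanned by all vertices of height at most $n$. $S_n$ is the finite set of plane trees of height exactly $n$ with all branching numbers at most $D$. For $N$ sufficiently large, $\pi_{n,N}$ maps $\mathbb{T}_N$ into $S_n$, and $P_n$ denotes the probability measure on $S_n$ that is the limit in total variation, as $N\to\infty$, of the push-forwards $\mu_N\pi_{n,N}^{-1}$ (this limit exists). The space $\mathbb{T}$ of all plane trees, finite or infinite, with branching numbers at most $D$ is identified with a subset of $\mathbb{X}=\prod_{n=1}^\infty\{0,1,\ldots,D^{n-1}\}^{D^n}$ (with the product topology, each factor being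 discrete) as follows: the vertices of height $n$ (the $n$-th level) are naturally ordered and enumerated by $1,\ldots,r_n$ ($r_n\le D^n$); $g_{n,l}$ is the number of the parent (in the enumeration of level $n-1$) of the $l$-th vertex of level $n$ if $1\le l\le r_n$, and $g_{n,l}=0$ if $r_n<l\le D^n$; the tree is identified with $(g_1,g_2,\ldots)$, $g_n=(g_{n,1},\ldots,g_{n,D^n})$. Thus every measure on $\mathbb{T}_N$ or on $\mathbb{T}$ is also viewed as a measure on $\mathbb{X}$. $P_\infty$ denotes the unique probability measure on $\mathbb{T}$ whose push-forward under $\pi_n$ (taking a tree to its subtree spanned by the vertices of height at most $n$) equals $P_n$ for every $n\in\mathbb{N}$. *)

theory Defs
  imports "HOL-Probability.Probability"
begin

text \<open>
  Plane trees are represented by Neveu's canonical model: a vertex is the list of the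
  (0-based) birth ranks on the path leading to it from the root \<^term>\<open>[]\<close>, and a tree
  is a prefix-closed set of vertices that contains all older siblings of its members.
  Every locally finite plane tree, finite or infinite, is isomorphic to exactly one such set.
\<close>

type_synonym vertex = "nat list"

type_synonym tree = "vertex set"

definition plane_tree :: "tree \<Rightarrow> bool" where
  "plane_tree T \<longleftrightarrow> [] \<in> T \<and> (\<forall>v i. v @ [i] \<in> T \<longrightarrow> v \<in> T \<and> (\<forall>j<i. v @ [j] \<in> T))"

definition kids :: "tree \<Rightarrow> vertex \<Rightarrow> vertex set" where
  "kids T v = {w \<in> T. \<exists>i. w = v @ [i]}"

definition branching :: "tree \<Rightarrow> vertex \<Rightarrow> nat" where
  "branching T v = card (kids T v)"

definition tree_height :: "tree \<Rightarrow> nat" where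
  "tree_height T = Max (length ` T)"

definition all_trees :: "nat \<Rightarrow> tree set" where
  "all_trees D = {T. plane_tree T \<and> (\<forall>v\<in>T. finite (kids T v) \<and> branching T v \<le> D)}"

definition trees_of_size :: "nat \<Rightarrow> nat \<Rightarrow> tree set" where
  "trees_of_size D N = {T \<in> all_trees D. finite T \<and> card T = N}"

definition trees_of_height :: "nat \<Rightarrow> nat \<Rightarrow> tree set" where
  "trees_of_height D n = {T \<in> all_trees D. finite T \<and> tree_height T = n}"

definition truncate :: "nat \<Rightarrow> tree \<Rightarrow> tree" where
  "truncate n T = {v \<in> T. length v \<le> n}"

definition energy :: "(nat \<Rightarrow> real) \<Rightarrow> tree \<Rightarrow> real" where
  "energy E T = (\<Sum>v\<in>T. E (branching T v))"

definition partition_fn :: "nat \<Rightarrow> (nat \<Rightarrow> real) \<Rightarrow> real \<Rightarrow> nat \<Rightarrow> real" where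
  "partition_fn D E \<beta> N = (\<Sum>T\<in>trees_of_size D N. exp (- \<beta> * energy E T))"

definition gibbs :: "nat \<Rightarrow> (nat \<Rightarrow> real) \<Rightarrow> real \<Rightarrow> nat \<Rightarrow> tree measure" where
  "gibbs D E \<beta> N =
     point_measure (trees_of_size D N)
       (\<lambda>T. ennreal (exp (- \<beta> * energy E T) / partition_fn D E \<beta> N))"

definition level :: "tree \<Rightarrow> nat \<Rightarrow> vertex set" where
  "level T n = {v \<in> T. length v = n}"

text \<open>
  The number (starting from 1) of a vertex within its level.  The relation
  \<^term>\<open>lex less_than\<close> only relates lists of equal length; on a level it orders vertices
  by the order of their parents and siblings by their birth rank.
\<close>

definition vertex_number :: "tree \<Rightarrow> vertex \<Rightarrow> nat" where
  "vertex_number T v = card {w \<in> level T (length v). w = v \<or> (w, v) \<in> lex less_than}"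

definition nth_vertex :: "tree \<Rightarrow> nat \<Rightarrow> nat \<Rightarrow> vertex" where
  "nth_vertex T n l = (THE v. v \<in> level T n \<and> vertex_number T v = l)"

definition parent_number :: "tree \<Rightarrow> nat \<Rightarrow> nat \<Rightarrow> nat" where
  "parent_number T n l =
     (if 1 \<le> l \<and> l \<le> card (level T n) then vertex_number T (butlast (nth_vertex T n l)) else 0)"

definition code_space :: "nat \<Rightarrow> (nat \<Rightarrow> nat \<Rightarrow> nat) topology" where
  "code_space D =
     product_topology (\<lambda>n. discrete_topology ({1..D ^ n} \<rightarrow>\<^sub>E {0..D ^ (n - 1)})) {1..}"

definition encode :: "nat \<Rightarrow> tree \<Rightarrow> nat \<Rightarrow> nat \<Rightarrow> nat" where
  "encode D T = (\<lambda>n\<in>{1..}. \<lambda>l\<in>{1..D ^ n}. parent_number T n l)"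

definition borel_algebra :: "'a topology \<Rightarrow> 'a measure" where
  "borel_algebra X = sigma (topspace X) {U. openin X U}"

text \<open>The trace on the set of trees of the Borel sets of the code space.\<close>

definition tree_algebra :: "nat \<Rightarrow> tree measure" where
  "tree_algebra D = vimage_algebra (all_trees D) (encode D) (borel_algebra (code_space D))"

definition on_codes :: "nat \<Rightarrow> tree measure \<Rightarrow> (nat \<Rightarrow> nat \<Rightarrow> nat) measure" where
  "on_codes D M = distr M (borel_algebra (code_space D)) (encode D)"

definition total_variation :: "'a measure \<Rightarrow> 'a measure \<Rightarrow> real" where
  "total_variation M L = (SUP A\<in>sets M. \<bar>measure M A - measure L A\<bar>)"

text \<open>
  The push-forwards live on the set of all trees; for small \<open>N\<close> they need not be
  supported by the trees of height \<open>n\<close>, but their limit \<open>P\<close> is required to be.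
\<close>

definition is_truncation_limit ::
    "nat \<Rightarrow> (nat \<Rightarrow> real) \<Rightarrow> real \<Rightarrow> nat \<Rightarrow> tree pmf \<Rightarrow> bool" where
  "is_truncation_limit D E \<beta> n P \<longleftrightarrow>
     set_pmf P \<subseteq> trees_of_height D n \<and>
     (\<lambda>N. total_variation (distr (gibbs D E \<beta> N) (count_space UNIV) (truncate n))
            (measure_pmf P)) \<longlonglongrightarrow> 0"

definition is_infinite_volume_measure ::
    "nat \<Rightarrow> (nat \<Rightarrow> tree pmf) \<Rightarrow> tree measure \<Rightarrow> bool" where
  "is_infinite_volume_measure D P Q \<longleftrightarrow>
     prob_space Q \<and> sets Q = sets (tree_algebra D) \<and>
     (\<forall>n\<ge>1. distr Q (count_space UNIV) (truncate n) = measure_pmf (P n))"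

definition converges_weakly :: "'a topology \<Rightarrow> (nat \<Rightarrow> 'a measure) \<Rightarrow> 'a measure \<Rightarrow> bool" where
  "converges_weakly X M L \<longleftrightarrow>
     (\<forall>f. continuous_map X euclideanreal f \<and> bounded (f ` topspace X) \<longrightarrow>
        (\<lambda>N. integral\<^sup>L (M N) f) \<longlonglongrightarrow> integral\<^sup>L L f)"

end

theory Submission
  imports Defs
begin

text \<open>
  By compactness of the code space, a continuous function of the code is uniformly close to a
  function of its first \<open>n\<close> components, hence to a function of the truncation at height \<open>n\<close>.
  There are only finitely many truncated trees, so convergence in total variation of the
  truncations gives convergence of the integrals of such functions, and the error of the uniform
  approximation is controlled because all the measures involved have mass at most \<open>1\<close>.
\<close>

section \<open>Codes of trees\<close>

text \<open>A child of birth rank \<open>i\<close> comes with all its older siblings, so its parent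
  has at least \<open>i + 1\<close> children and \<open>i < D\<close>. Confining trees to words over
  a finite alphabet is the source of the finiteness statements below.\<close>

lemma all_trees_subset_lists:
  assumes "T \<in> all_trees D"
  shows "T \<subseteq> lists {..<D}"
proof
  fix v assume "v \<in> T"
  then show "v \<in> lists {..<D}"
  proof (induction v rule: rev_induct)
    case Nil
    then show ?case by simp
  next
    case (snoc i v)
    then have v: "v \<in> T" and sib: "\<And>j. j \<le> i \<Longrightarrow> v @ [j] \<in> T"
      using assms by (auto simp: all_trees_def plane_tree_def le_less)
    have "card ((\<lambda>j. v @ [j]) ` {..i}) \<le> card (kids T v)"
      using assms v sib by (intro card_mono) (auto simp: all_trees_def kids_def)
    also have "\<dots> \<le> D"
      using assms v by (auto simp: all_trees_def branching_def)
    finally have "i < D"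
      by (simp add: card_image inj_on_def)
    with snoc.IH v show ?case by simp
  qed
qed

lemma
  assumes "T \<in> all_trees D"
  shows finite_level: "finite (level T n)" and card_level_le: "card (level T n) \<le> D ^ n"
proof -
  have "level T n \<subseteq> {v. set v \<subseteq> {..<D} \<and> length v = n}"
    using all_trees_subset_lists[OF assms] by (auto simp: level_def)
  then show "finite (level T n)" "card (level T n) \<le> D ^ n"
    using finite_lists_length_eq[of "{..<D}" n] card_lists_length_eq[of "{..<D}" n]
    by (auto intro: finite_subset dest: card_mono[rotated])
qed

lemma finite_truncations: "finite (truncate n ` all_trees D)"
proof (rule finite_subset)
  show "truncate n ` all_trees D \<subseteq> Pow {v. set v \<subseteq> {..<D} \<and> length v \<le> n}"
    using all_trees_subset_lists by (fastforce simp: truncate_def)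
  show "finite (Pow {v. set v \<subseteq> {..<D} \<and> length v \<le> n})"
    using finite_lists_length_le[of "{..<D}" n] by simp
qed

lemma take_mem_plane_tree:
  assumes "plane_tree T" "v \<in> T"
  shows "take k v \<in> T"
  using assms(2)
proof (induction v rule: rev_induct)
  case Nil
  then show ?case by simp
next
  case (snoc i v)
  then have "v \<in> T"
    using assms(1) unfolding plane_tree_def by blast
  with snoc show ?case
    by (cases "k \<le> length v") simp_all
qed

text \<open>The \<open>length v + 1\<close> prefixes of \<open>v\<close> are distinct vertices of
  \<open>T\<close>. Hence truncation at height \<open>N\<close> leaves a tree with \<open>N\<close>
  vertices unchanged.\<close>

lemma length_le_card:
  assumes "plane_tree T" "finite T" "v \<in> T"
  shows "length v \<le> card T"
proof -
  have "inj_on (\<lambda>k. take k v) {..length v}"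
    by (rule inj_onI) (auto dest: arg_cong[where f = length])
  then have "card {..length v} = card ((\<lambda>k. take k v) ` {..length v})"
    by (simp add: card_image)
  also have "\<dots> \<le> card T"
    using assms by (intro card_mono) (auto intro: take_mem_plane_tree)
  finally show ?thesis by simp
qed

lemma finite_trees_of_size: "finite (trees_of_size D N)"
proof (rule finite_subset)
  show "trees_of_size D N \<subseteq> truncate N ` all_trees D"
  proof
    fix T assume "T \<in> trees_of_size D N"
    then have "T \<in> all_trees D" "truncate N T = T"
      using length_le_card by (auto simp: trees_of_size_def truncate_def all_trees_def)
    then show "T \<in> truncate N ` all_trees D" by force
  qed
qed (rule finite_truncations)

lemma trees_of_height_subset: "trees_of_height D n \<subseteq> truncate n ` all_trees D"
proof
  fix T assume "T \<in> trees_of_height D n"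
  then have "T \<in> all_trees D" "truncate n T = T"
    by (auto simp: trees_of_height_def truncate_def tree_height_def)
  then show "T \<in> truncate n ` all_trees D" by force
qed

section \<open>Numbering of the vertices of a level, and codes of truncated trees\<close>

text \<open>The rank strictly increases along \<open>r\<close>, so totality makes it injective. It
  is at least 1 because \<open>v\<close> counts itself, and an injection into a set of equal finite
  size is onto.\<close>

lemma bij_betw_rank:
  assumes "finite A" "trans r" "irrefl r" "total_on A r"
  shows "bij_betw (\<lambda>v. card {w \<in> A. w = v \<or> (w, v) \<in> r}) A {1..card A}"
proof -
  let ?B = "\<lambda>v. {w \<in> A. w = v \<or> (w, v) \<in> r}"
  have less: "card (?B v) < card (?B w)" if "v \<in> A" "w \<in> A" "(v, w) \<in> r" for v w
  proof (rule psubset_card_mono)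
    have "w \<noteq> v" "(w, v) \<notin> r"
      using that(3) transD[OF assms(2), of v w v] assms(3) by (auto simp: irrefl_def)
    then have "w \<notin> ?B v"
      by simp
    moreover have "?B v \<subseteq> ?B w"
      using that(3) transD[OF assms(2), of _ v w] by blast
    ultimately show "?B v \<subset> ?B w"
      using that by blast
  qed (use assms(1) in auto)
  have inj: "inj_on (\<lambda>v. card (?B v)) A"
  proof (rule inj_onI, rule ccontr)
    fix v w assume vw: "v \<in> A" "w \<in> A" "card (?B v) = card (?B w)" "v \<noteq> w"
    then have "(v, w) \<in> r \<or> (w, v) \<in> r"
      using assms(4) by (auto simp: total_on_def)
    then show False
      using less[of v w] less[of w v] vw by linarith
  qed
  have "(\<lambda>v. card (?B v)) ` A \<subseteq> {1..card A}"
  proof clarify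
    fix v assume "v \<in> A"
    then have "{v} \<subseteq> ?B v" "?B v \<subseteq> A" by auto
    then show "card (?B v) \<in> {1..card A}"
      using assms(1) card_mono[of "?B v" "{v}"] card_mono[of A "?B v"] finite_subset[of "?B v" A]
      by auto
  qed
  then have "(\<lambda>v. card (?B v)) ` A = {1..card A}"
    by (rule card_subset_eq[rotated]) (use inj in \<open>auto simp: card_image\<close>)
  with inj show ?thesis by (simp add: bij_betw_def)
qed

lemma bij_betw_vertex_number:
  assumes "finite (level T n)"
  shows "bij_betw (vertex_number T) (level T n) {1..card (level T n)}"
proof -
  \<comment> \<open>\<open>lenlex\<close> is total, and between words of equal length it reduces to
    \<open>lex\<close>.\<close>
  have "total_on (level T n) (lex less_than)"
    using total_lenlex[OF total_less_than]
    by (fastforce simp: total_on_def level_def lenlex_def)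
  with assms have "bij_betw (\<lambda>v. card {w \<in> level T n. w = v \<or> (w, v) \<in> lex less_than})
      (level T n) {1..card (level T n)}"
    by (intro bij_betw_rank lex_transI irrefl_lex) (auto simp: irrefl_def)
  then show ?thesis
    by (rule bij_betw_cong[THEN iffD1, rotated]) (simp add: vertex_number_def level_def)
qed

text \<open>Bijectivity of the numbering makes the definite description in \<open>nth_vertex\<close>
  meaningful.\<close>

lemma nth_vertex_mem_level:
  assumes "finite (level T n)" "1 \<le> l" "l \<le> card (level T n)"
  shows "nth_vertex T n l \<in> level T n"
proof -
  have "\<exists>!v. v \<in> level T n \<and> vertex_number T v = l"
    using bij_betw_vertex_number[OF assms(1)] assms(2,3)
    by (auto simp: bij_betw_def inj_on_def image_iff set_eq_iff) metis
  from theI'[OF this] show ?thesis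
    by (simp add: nth_vertex_def)
qed

lemma parent_number_le:
  assumes "T \<in> all_trees D"
  shows "parent_number T n l \<le> D ^ (n - 1)"
proof (cases "1 \<le> l \<and> l \<le> card (level T n)")
  case True
  define w where "w = butlast (nth_vertex T n l)"
  \<comment> \<open>For \<open>n = 0\<close> the truncated subtraction is consistent with
    \<open>butlast [] = []\<close>. The length alone yields the bound, since a vertex number counts
    within the level of that length.\<close>
  have "length w = n - 1"
    using nth_vertex_mem_level[OF finite_level[OF assms]] True by (auto simp: w_def level_def)
  then have "vertex_number T w \<le> card (level T (n - 1))"
    unfolding vertex_number_def using finite_level[OF assms] by (intro card_mono) auto
  with True show ?thesis
    using card_level_le[OF assms, of "n - 1"] by (simp add: parent_number_def w_def)
qed (auto simp: parent_number_def)

lemma encode_mem_code_space: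
  assumes "T \<in> all_trees D"
  shows "encode D T \<in> topspace (code_space D)"
  using parent_number_le[OF assms] by (auto simp: code_space_def encode_def)

lemma level_truncate: "k \<le> n \<Longrightarrow> level (truncate n T) k = level T k"
  by (auto simp: level_def truncate_def)

text \<open>The parent numbers at level \<open>k\<close> depend only on level \<open>k\<close> and
  the level of the parents, and truncation at height \<open>n \<ge> k\<close> preserves
  both.\<close>

lemma parent_number_truncate:
  assumes "T \<in> all_trees D" "k \<le> n"
  shows "parent_number (truncate n T) k l = parent_number T k l"
proof (cases "1 \<le> l \<and> l \<le> card (level T k)")
  case True
  have vn: "vertex_number (truncate n T) v = vertex_number T v" if "length v \<le> n" for v
    using that by (simp add: vertex_number_def level_truncate)
  have "nth_vertex (truncate n T) k l = nth_vertex T k l"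
    unfolding nth_vertex_def
    by (intro arg_cong[where f = The] ext)
      (use assms(2) vn in \<open>auto simp: level_truncate level_def truncate_def\<close>)
  moreover have "length (nth_vertex T k l) = k"
    using nth_vertex_mem_level[OF finite_level[OF assms(1)]] True by (auto simp: level_def)
  ultimately show ?thesis
    using True assms(2) vn by (simp add: parent_number_def level_truncate)
qed (use assms(2) in \<open>auto simp: parent_number_def level_truncate\<close>)

lemma encode_truncate:
  assumes "T \<in> all_trees D" "k \<le> n"
  shows "encode D (truncate n T) k = encode D T k"
  using parent_number_truncate[OF assms] by (auto simp: encode_def fun_eq_iff)

section \<open>Functions of finitely many coordinates\<close>

lemma continuous_map_product_truncation:
  assumes "z \<in> topspace (product_topology X I)"
  shows "continuous_map (product_topology X I) (product_topology X I)
           (\<lambda>y. \<lambda>i\<in>I. if i \<le> (n::nat) then y i else z i)"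
  using assms
  by (auto simp: continuous_map_componentwise PiE_iff if_distrib[of "\<lambda>g. g _"]
      intro: continuous_map_product_projection)

text \<open>Every point has an open box on which \<open>f\<close> oscillates by less than
  \<open>\<epsilon>\<close> and which restricts only finitely many coordinates. By compactness
  finitely many boxes suffice; changing coordinates beyond the last one they restrict never leaves a
  box.\<close>

lemma uniform_approx_product_truncation:
  fixes I :: "nat set" and f :: "(nat \<Rightarrow> 'a) \<Rightarrow> 'b::metric_space"
  assumes "\<And>i. i \<in> I \<Longrightarrow> compact_space (X i)"
    and f: "continuous_map (product_topology X I) euclidean f"
    and z: "z \<in> topspace (product_topology X I)" and "\<epsilon> > 0"
  shows "\<exists>n. \<forall>m\<ge>n. \<forall>y\<in>topspace (product_topology X I).
           dist (f y) (f (\<lambda>i\<in>I. if i \<le> m then y i else z i)) < \<epsilon>"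
proof -
  let ?Y = "product_topology X I"
  \<comment> \<open>The bound \<open>n\<close> past which a box is unrestricted is built into the
    family, so that a maximum can be taken over a finite subcover.\<close>
  define \<U> where "\<U> = {S. \<exists>U n. S = Pi\<^sub>E I U \<and> openin ?Y S
      \<and> (\<forall>i\<in>I. n < i \<longrightarrow> U i = topspace (X i)) \<and> (\<forall>a\<in>S. \<forall>b\<in>S. dist (f a) (f b) < \<epsilon>)}"
  have cover: "\<exists>S\<in>\<U>. x \<in> S" if x: "x \<in> topspace ?Y" for x
  proof -
    \<comment> \<open>The radius is halved because two arbitrary points of the box are compared
      through \<open>x\<close>.\<close>
    let ?V = "{y \<in> topspace ?Y. f y \<in> ball (f x) (\<epsilon> / 2)}"
    have "openin ?Y ?V"
      by (rule openin_continuous_map_preimage[OF f]) auto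
    moreover have "x \<in> ?V" using x \<open>\<epsilon> > 0\<close> by auto
    ultimately obtain U where U: "finite {i \<in> I. U i \<noteq> topspace (X i)}"
      "\<And>i. i \<in> I \<Longrightarrow> openin (X i) (U i)" "x \<in> Pi\<^sub>E I U" "Pi\<^sub>E I U \<subseteq> ?V"
      unfolding openin_product_topology_alt by meson
    obtain n where "\<forall>i\<in>{i \<in> I. U i \<noteq> topspace (X i)}. i \<le> n"
      using U(1) finite_nat_set_iff_bounded_le by blast
    then have "\<forall>i\<in>I. n < i \<longrightarrow> U i = topspace (X i)"
      by force
    moreover have "dist (f a) (f b) < \<epsilon>" if "a \<in> Pi\<^sub>E I U" "b \<in> Pi\<^sub>E I U" for a b
    proof -
      have "f a \<in> ball (f x) (\<epsilon> / 2)" "f b \<in> ball (f x) (\<epsilon> / 2)"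
        using that U(4) by blast+
      then show ?thesis
        by (auto intro: dist_triangle_half_r)
    qed
    moreover have "openin ?Y (Pi\<^sub>E I U)"
      using U(1,2) by (simp add: openin_PiE_gen)
    ultimately have "Pi\<^sub>E I U \<in> \<U>"
      unfolding \<U>_def by blast
    with U(3) show ?thesis by blast
  qed
  have "compact_space ?Y"
    using assms(1) by (auto simp: compact_space_product_topology)
  moreover have "\<forall>S\<in>\<U>. openin ?Y S"
    by (auto simp: \<U>_def)
  moreover have "topspace ?Y \<subseteq> \<Union>\<U>"
    using cover by blast
  ultimately obtain \<F> where F: "finite \<F>" "\<F> \<subseteq> \<U>" "topspace ?Y \<subseteq> \<Union>\<F>"
    unfolding compact_space_alt by meson
  have "\<exists>n U. S = Pi\<^sub>E I U \<and> (\<forall>i\<in>I. n < i \<longrightarrow> U i = topspace (X i))" if "S \<in> \<F>" for S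
  proof -
    have "S \<in> \<U>"
      using that F(2) by blast
    then show ?thesis
      unfolding \<U>_def mem_Collect_eq by (elim exE conjE) (intro exI conjI)
  qed
  then obtain n U where n:
    "\<And>S. S \<in> \<F> \<Longrightarrow> S = Pi\<^sub>E I (U S) \<and> (\<forall>i\<in>I. n S < i \<longrightarrow> U S i = topspace (X i))"
    by metis
  show ?thesis
  proof (intro exI[of _ "Max (n ` \<F>)"] allI impI ballI)
    fix m y assume m: "Max (n ` \<F>) \<le> m" and y: "y \<in> topspace ?Y"
    then obtain S where S: "S \<in> \<F>" "y \<in> S" using F(3) by auto
    have U: "S = Pi\<^sub>E I (U S)" "\<And>i. i \<in> I \<Longrightarrow> n S < i \<Longrightarrow> U S i = topspace (X i)"
      using n[OF S(1)] by auto
    have "n S \<le> m"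
      using m Max_ge[of "n ` \<F>" "n S"] S(1) F(1) by (meson finite_imageI imageI order_trans)
    \<comment> \<open>Up to \<open>m\<close> the coordinates are those of \<open>y\<close>, which
      lies in the box; beyond \<open>m\<close> the box is the whole factor, which contains
      \<open>z i\<close>.\<close>
    have "(if i \<le> m then y i else z i) \<in> U S i" if "i \<in> I" for i
    proof (cases "i \<le> m")
      case True
      have "y \<in> Pi\<^sub>E I (U S)" using S(2) U(1) by simp
      with True that show ?thesis by (simp add: PiE_iff)
    next
      case False
      with \<open>n S \<le> m\<close> that z show ?thesis by (simp add: U(2) PiE_iff)
    qed
    then have "(\<lambda>i\<in>I. if i \<le> m then y i else z i) \<in> S"
      by (subst U(1)) simp
    moreover have "\<forall>a\<in>S. \<forall>b\<in>S. dist (f a) (f b) < \<epsilon>"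
      using S(1) F(2) by (auto simp: \<U>_def)
    ultimately show "dist (f y) (f (\<lambda>i\<in>I. if i \<le> m then y i else z i)) < \<epsilon>"
      using S(2) by blast
  qed
qed

lemma borel_measurable_continuous_map:
  fixes f :: "'a \<Rightarrow> 'b::topological_space"
  assumes "continuous_map X euclidean f"
  shows "f \<in> borel_measurable (borel_algebra X)"
proof (rule borel_measurableI)
  have X: "{U. openin X U} \<subseteq> Pow (topspace X)"
    by (auto dest: openin_subset)
  fix S :: "'b set" assume "open S"
  then have "openin X {x \<in> topspace X. f x \<in> S}"
    using assms by (auto intro: openin_continuous_map_preimage)
  then have "{x \<in> topspace X. f x \<in> S} \<in> sets (borel_algebra X)"
    using X by (auto simp: borel_algebra_def)
  moreover have "{x \<in> topspace X. f x \<in> S} = f -` S \<inter> space (borel_algebra X)"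
    using X by (auto simp: borel_algebra_def)
  ultimately show "f -` S \<inter> space (borel_algebra X) \<in> sets (borel_algebra X)"
    by simp
qed

section \<open>Convergence of integrals\<close>

lemma integral_finite_support:
  fixes h :: "'a \<Rightarrow> real"
  assumes "finite_measure M" "sets M = UNIV" "finite K" "AE x in M. x \<in> K"
  shows "integral\<^sup>L M h = (\<Sum>k\<in>K. h k * measure M {k})"
proof -
  interpret finite_measure M by fact
  have [measurable]: "g \<in> borel_measurable M" for g :: "'a \<Rightarrow> real"
    using assms(2) sets_eq_imp_space_eq[of M "count_space UNIV"] by (auto simp: measurable_def)
  have "integral\<^sup>L M h = (\<integral>x. (\<Sum>k\<in>K. h k * indicator {k} x) \<partial>M)"
    using assms(4)
  proof (intro integral_cong_AE)
    show "AE x in M. h x = (\<Sum>k\<in>K. h k * indicator {k} x)"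
      using assms(4)
    proof eventually_elim
      case (elim x)
      then show ?case
        using assms(3) by (subst sum.remove[of _ x]) (auto intro!: sum.neutral)
    qed
  qed auto
  also have "\<dots> = (\<Sum>k\<in>K. h k * measure M {k})"
    using assms(2) by (subst Bochner_Integration.integral_sum) (auto simp: less_top[symmetric])
  finally show ?thesis .
qed

text \<open>The real supremum bounds its members only if they are bounded above; the sum of the two
  total masses is such a bound.\<close>

lemma measure_diff_le_total_variation:
  assumes "finite_measure M" "finite_measure L" "A \<in> sets M"
  shows "\<bar>measure M A - measure L A\<bar> \<le> total_variation M L"
proof -
  have "\<bar>measure M B - measure L B\<bar> \<le> measure M (space M) + measure L (space L)" for B
    using finite_measure.bounded_measure[OF assms(1), of B]
      finite_measure.bounded_measure[OF assms(2), of B] by (smt (verit) measure_nonneg)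
  then have "bdd_above ((\<lambda>A. \<bar>measure M A - measure L A\<bar>) ` sets M)"
    by (intro bdd_aboveI2)
  then show ?thesis
    unfolding total_variation_def using assms(3) by (rule cSUP_upper2) simp
qed

text \<open>Total variation controls each point mass, and on the common finite support
  \<open>K\<close> every integral is a finite combination of point masses, so \<open>h\<close> may
  be arbitrary.\<close>

lemma tendsto_integral_total_variation:
  fixes h :: "'a \<Rightarrow> real"
  assumes "\<And>N. finite_measure (M N)" "\<And>N. sets (M N) = UNIV" "\<And>N. AE x in M N. x \<in> K"
    and "finite_measure L" "sets L = UNIV" "AE x in L. x \<in> K"
    and "finite K" "(\<lambda>N. total_variation (M N) L) \<longlonglongrightarrow> 0"
  shows "(\<lambda>N. integral\<^sup>L (M N) h) \<longlonglongrightarrow> integral\<^sup>L L h"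
proof -
  have "(\<lambda>N. measure (M N) {k}) \<longlonglongrightarrow> measure L {k}" for k
  proof (rule LIM_zero_cancel, rule Lim_null_comparison[OF always_eventually assms(8)])
    show "\<forall>N. norm (measure (M N) {k} - measure L {k}) \<le> total_variation (M N) L"
      using assms(1,2,4) by (auto intro: measure_diff_le_total_variation)
  qed
  then have "(\<lambda>N. \<Sum>k\<in>K. h k * measure (M N) {k}) \<longlonglongrightarrow> (\<Sum>k\<in>K. h k * measure L {k})"
    by (intro tendsto_intros)
  with assms(1-7) show ?thesis
    by (simp add: integral_finite_support)
qed

lemma emeasure_gibbs_le: "emeasure (gibbs D E \<beta> N) (space (gibbs D E \<beta> N)) \<le> 1"
proof -
  let ?w = "\<lambda>T. exp (- \<beta> * energy E T)"
  have "emeasure (gibbs D E \<beta> N) (space (gibbs D E \<beta> N))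
      = (\<Sum>T\<in>trees_of_size D N. ennreal (?w T / partition_fn D E \<beta> N))"
    by (simp add: gibbs_def space_point_measure emeasure_point_measure_finite finite_trees_of_size)
  also have "\<dots> = ennreal (\<Sum>T\<in>trees_of_size D N. ?w T / partition_fn D E \<beta> N)"
    by (intro sum_ennreal) (auto simp: partition_fn_def intro!: divide_nonneg_nonneg sum_nonneg)
  also have "\<dots> = ennreal (partition_fn D E \<beta> N / partition_fn D E \<beta> N)"
    unfolding sum_divide_distrib[symmetric] by (simp only: partition_fn_def)
  \<comment> \<open>If no tree has \<open>N\<close> vertices, as for \<open>N = 0\<close>, the
    partition function is 0 and the quotient is 0 by convention. Hence the mass is only claimed to
    be at most 1.\<close>
  also have "\<dots> \<le> 1"
    by (cases "partition_fn D E \<beta> N = 0") auto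
  finally show ?thesis .
qed

text \<open>Since the mass is at most 1, a uniform error passes to the integrals with no constant
  depending on \<open>M\<close>.\<close>

lemma abs_integral_diff_le:
  fixes F G :: "'a \<Rightarrow> real"
  assumes "emeasure M (space M) \<le> 1"
    and F: "F \<in> borel_measurable M" "\<And>x. x \<in> space M \<Longrightarrow> \<bar>F x\<bar> \<le> C"
    and G: "G \<in> borel_measurable M" "\<And>x. x \<in> space M \<Longrightarrow> \<bar>G x\<bar> \<le> C"
    and close: "\<And>x. x \<in> space M \<Longrightarrow> \<bar>F x - G x\<bar> \<le> \<epsilon>" and "\<epsilon> \<ge> 0"
  shows "\<bar>integral\<^sup>L M F - integral\<^sup>L M G\<bar> \<le> \<epsilon>"
proof -
  interpret finite_measure M
    by (rule finite_measureI) (use assms(1) in \<open>auto simp: top_unique\<close>)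
  have int: "integrable M F" "integrable M G"
    using F G by (auto intro: integrable_const_bound[where B = C])
  have "\<bar>integral\<^sup>L M F - integral\<^sup>L M G\<bar> = \<bar>\<integral>x. F x - G x \<partial>M\<bar>"
    using int by simp
  also have "\<dots> \<le> (\<integral>x. \<bar>F x - G x\<bar> \<partial>M)"
    by (rule integral_abs_bound)
  also have "\<dots> \<le> (\<integral>x. \<epsilon> \<partial>M)"
    using int close by (intro integral_mono) auto
  also have "\<dots> \<le> \<epsilon>"
    using assms(1) \<open>\<epsilon> \<ge> 0\<close> by (simp add: emeasure_eq_measure mult_left_le_one_le)
  finally show ?thesis .
qed

text \<open>
  The map \<open>t\<close> need not be known to be measurable: if its push-forward set function were not a
  measure, then \<^const>\<open>distr\<close> would be the null measure and not a probability measure.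
\<close>

lemma emeasure_distr_eq_prob_space:
  assumes "distr M K t = L" "prob_space L" "A \<in> sets K"
  shows "emeasure M (t -` A \<inter> space M) = emeasure L A"
proof -
  let ?\<mu> = "\<lambda>A. emeasure M (t -` A \<inter> space M)"
  have "emeasure (distr M K t) (space K) = 1"
    using assms(1) prob_space.emeasure_space_1[OF assms(2)] by (metis space_distr)
  then have "measure_space (space K) (sigma_sets (space K) (sets K)) ?\<mu>"
    unfolding distr_def emeasure_measure_of_conv by (auto split: if_splits)
  then have "emeasure (distr M K t) A = ?\<mu> A"
    using assms(3) unfolding distr_def emeasure_measure_of_conv
    by (simp add: sets.sigma_sets_eq)
  with assms(1) show ?thesis by simp
qed

text \<open>Measurability of \<open>t\<close> is not assumed, so there is no direct change of
  variables along \<open>t\<close>. Instead the laws of \<open>G\<close> and \<open>h\<close> on the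
  real line are shown to coincide, and these determine the integrals.\<close>

lemma integral_via_pmf:
  fixes h :: "'b \<Rightarrow> real"
  assumes "distr Q (count_space UNIV) t = measure_pmf p"
    and G: "G \<in> borel_measurable Q" "\<And>x. x \<in> space Q \<Longrightarrow> G x = h (t x)"
  shows "integral\<^sup>L Q G = integral\<^sup>L (measure_pmf p) h"
proof -
  have "distr Q borel G = distr (measure_pmf p) borel h"
  proof (rule measure_eqI)
    fix B assume "B \<in> sets (distr Q borel G)"
    then have B: "B \<in> sets borel" by simp
    have "emeasure (distr Q borel G) B = emeasure Q (t -` (h -` B) \<inter> space Q)"
      using B G by (auto simp: emeasure_distr intro!: arg_cong[where f = "emeasure Q"])
    also have "\<dots> = emeasure (measure_pmf p) (h -` B)"
      by (rule emeasure_distr_eq_prob_space[OF assms(1)]) (auto intro: prob_space_measure_pmf)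
    also have "\<dots> = emeasure (distr (measure_pmf p) borel h) B"
      using B by (simp add: emeasure_distr)
    finally show "emeasure (distr Q borel G) B = emeasure (distr (measure_pmf p) borel h) B" .
  qed simp
  then have "(\<integral>x. x \<partial>distr Q borel G) = (\<integral>x. x \<partial>distr (measure_pmf p) borel h)"
    by simp
  then show ?thesis
    using G(1) by (simp add: integral_distr)
qed

section \<open>Weak convergence\<close>

theorem theorem6:
  fixes D :: nat and E :: "nat \<Rightarrow> real" and \<beta> :: real
    and P :: "nat \<Rightarrow> tree pmf" and P_inf :: "tree measure"
  assumes "D \<ge> 1"
    and "\<And>n. n \<ge> 1 \<Longrightarrow> is_truncation_limit D E \<beta> n (P n)"
    and "is_infinite_volume_measure D P P_inf"
  shows "converges_weakly (code_space D) (\<lambda>N. on_codes D (gibbs D E \<beta> N)) (on_codes D P_inf)"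
  unfolding converges_weakly_def
proof (intro allI impI, elim conjE)
  fix f :: "(nat \<Rightarrow> nat \<Rightarrow> nat) \<Rightarrow> real"
  assume f: "continuous_map (code_space D) euclideanreal f"
    and "bounded (f ` topspace (code_space D))"
  then obtain C where C: "\<And>x. x \<in> topspace (code_space D) \<Longrightarrow> \<bar>f x\<bar> \<le> C"
    by (auto simp: bounded_iff)
  let ?\<mu> = "gibbs D E \<beta>" and ?B = "borel_algebra (code_space D)"
  have space_B: "space ?B = topspace (code_space D)"
    by (auto simp: borel_algebra_def space_measure_of_conv)
  have space_mu: "space (?\<mu> N) = trees_of_size D N" and sets_mu: "sets (?\<mu> N) = Pow (trees_of_size D N)"
    for N by (simp_all add: gibbs_def space_point_measure sets_point_measure)
  have trees: "trees_of_size D N \<subseteq> all_trees D" for N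
    by (auto simp: trees_of_size_def)
  \<comment> \<open>All subsets of \<open>trees_of_size D N\<close> are measurable for the Gibbs
    measure, so measurability is just a condition on the range.\<close>
  have mu_meas: "g \<in> measurable (?\<mu> N) L" if "g \<in> trees_of_size D N \<rightarrow> space L"
    for N L and g :: "tree \<Rightarrow> 'c"
    using that by (auto simp: measurable_def space_mu sets_mu)
  have fin_mu: "finite_measure (?\<mu> N)" for N
    by (rule finite_measureI) (use emeasure_gibbs_le[of D E \<beta> N] in \<open>auto simp: top_unique\<close>)
  interpret Q: prob_space P_inf
    using assms(3) by (simp add: is_infinite_volume_measure_def)
  have sets_Q: "sets P_inf = sets (tree_algebra D)"
    using assms(3) by (simp add: is_infinite_volume_measure_def)
  have space_Q: "space P_inf = all_trees D"
    using sets_eq_imp_space_eq[OF sets_Q] by (simp add: tree_algebra_def)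
  have enc_Q: "encode D \<in> measurable P_inf ?B"
    unfolding measurable_cong_sets[OF sets_Q refl] tree_algebra_def
    by (rule measurable_vimage_algebra1) (auto simp: space_B intro: encode_mem_code_space)
  have enc_mu: "encode D \<in> measurable (?\<mu> N) ?B" for N
    using trees by (intro mu_meas) (auto simp: space_B intro: encode_mem_code_space)
  have f_B: "f \<in> borel_measurable ?B"
    using f by (rule borel_measurable_continuous_map)

  \<comment> \<open>Zero entries stand for absent vertices, so on codes of trees
    \<open>cut n\<close> acts as truncation at height \<open>n\<close>.\<close>
  define z :: "nat \<Rightarrow> nat \<Rightarrow> nat" where "z = (\<lambda>n\<in>{1..}. \<lambda>l\<in>{1..D ^ n}. 0)"
  define cut where "cut n y = (\<lambda>i\<in>{1..}. if i \<le> n then y i else z i)" for n y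
  have z: "z \<in> topspace (code_space D)"
    by (auto simp: z_def code_space_def)
  have cut: "continuous_map (code_space D) (code_space D) (cut n)" for n
    using continuous_map_product_truncation z unfolding code_space_def cut_def by blast
  have cut_mem: "cut n y \<in> topspace (code_space D)" if "y \<in> topspace (code_space D)" for n y
    using cut that by (auto simp: continuous_map_def)
  have fcut_B: "(\<lambda>y. f (cut n y)) \<in> borel_measurable ?B" for n
    using continuous_map_compose[OF cut f]
    by (intro borel_measurable_continuous_map) (simp add: o_def)
  have cut_truncate: "cut n (encode D T) = cut n (encode D (truncate n T))"
    if "T \<in> all_trees D" for n T
    using encode_truncate[OF that] by (auto simp: cut_def fun_eq_iff)
  have approx: "\<exists>n\<ge>1. \<forall>y\<in>topspace (code_space D). \<bar>f y - f (cut n y)\<bar> \<le> \<epsilon>"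
    if "\<epsilon> > 0" for \<epsilon>
  proof -
    have "\<exists>n. \<forall>m\<ge>n. \<forall>y\<in>topspace (code_space D). dist (f y) (f (cut m y)) < \<epsilon>"
      unfolding cut_def code_space_def
      by (rule uniform_approx_product_truncation)
        (use f z that in \<open>auto simp: code_space_def compact_space_discrete_topology intro!: finite_PiE\<close>)
    then obtain n where "\<forall>m\<ge>n. \<forall>y\<in>topspace (code_space D). dist (f y) (f (cut m y)) < \<epsilon>"
      by blast
    then show ?thesis
      \<comment> \<open>The truncation limits are given for \<open>n \<ge> 1\<close> only; the
        approximation persists for larger indices.\<close>
      by (intro exI[of _ "max n 1"]) (auto simp: dist_real_def less_imp_le)
  qed

  \<comment> \<open>By \<open>cut_truncate\<close> the integrand factors through
    \<open>truncate n\<close>, which brings in the convergence in total variation to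
    \<open>P n\<close>.\<close>
  have cyl: "(\<lambda>N. \<integral>T. f (cut n (encode D T)) \<partial>?\<mu> N) \<longlonglongrightarrow> (\<integral>T. f (cut n (encode D T)) \<partial>P_inf)"
    if "n \<ge> 1" for n
  proof -
    define h where "h T = f (cut n (encode D T))" for T
    let ?\<nu> = "\<lambda>N. distr (?\<mu> N) (count_space UNIV) (truncate n)"
    have tr: "truncate n \<in> measurable (?\<mu> N) (count_space UNIV)" for N
      by (intro mu_meas) auto
    have lim: "set_pmf (P n) \<subseteq> trees_of_height D n"
      "(\<lambda>N. total_variation (?\<nu> N) (measure_pmf (P n))) \<longlonglongrightarrow> 0"
      using assms(2)[OF that] by (auto simp: is_truncation_limit_def)
    have "(\<lambda>N. integral\<^sup>L (?\<nu> N) h) \<longlonglongrightarrow> integral\<^sup>L (measure_pmf (P n)) h"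
    \<comment> \<open>\<open>K\<close> also contains trees of height below \<open>n\<close>, which
      can occur as truncations for small \<open>N\<close>.\<close>
    proof (rule tendsto_integral_total_variation[where K = "truncate n ` all_trees D"])
      show "AE T in ?\<nu> N. T \<in> truncate n ` all_trees D" for N
      proof -
        have "truncate n T \<in> truncate n ` all_trees D" if "T \<in> space (?\<mu> N)" for T
          using that trees[of N] by (intro imageI) (auto simp: space_mu)
        then show ?thesis
          using tr[of N] by (subst AE_distr_iff) auto
      qed
      show "AE T in measure_pmf (P n). T \<in> truncate n ` all_trees D"
        using lim(1) trees_of_height_subset[of D n] unfolding AE_measure_pmf_iff by blast
    qed (use fin_mu tr lim(2) finite_truncations
          in \<open>auto intro: finite_measure.finite_measure_distr measure_pmf.finite_measure_axioms\<close>)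
    moreover have "integral\<^sup>L (?\<nu> N) h = (\<integral>T. h T \<partial>?\<mu> N)" for N
    proof -
      have "integral\<^sup>L (?\<nu> N) h = (\<integral>T. h (truncate n T) \<partial>?\<mu> N)"
        using tr by (intro integral_distr) auto
      also have "\<dots> = (\<integral>T. h T \<partial>?\<mu> N)"
        using trees by (intro Bochner_Integration.integral_cong refl)
          (auto simp: space_mu h_def subset_iff simp flip: cut_truncate)
      finally show ?thesis .
    qed
    \<comment> \<open>Here only the push-forward identity for \<open>P_inf\<close> is at hand, while
      \<open>h\<close> itself is measurable through the code.\<close>
    moreover have "(\<integral>T. h T \<partial>P_inf) = integral\<^sup>L (measure_pmf (P n)) h"
    proof (rule integral_via_pmf)
      show "distr P_inf (count_space UNIV) (truncate n) = measure_pmf (P n)"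
        using assms(3) that by (simp add: is_infinite_volume_measure_def)
      show "h \<in> borel_measurable P_inf"
        unfolding h_def using measurable_compose[OF enc_Q fcut_B] .
      show "h T = h (truncate n T)" if "T \<in> space P_inf" for T
        using that by (simp add: space_Q h_def flip: cut_truncate)
    qed
    ultimately show ?thesis
      by (simp add: h_def)
  qed

  have "(\<lambda>N. \<integral>T. f (encode D T) \<partial>?\<mu> N) \<longlonglongrightarrow> (\<integral>T. f (encode D T) \<partial>P_inf)"
  proof (rule LIMSEQ_I)
    fix r :: real assume "r > 0"
    then obtain n where n: "n \<ge> 1" "\<And>y. y \<in> topspace (code_space D) \<Longrightarrow> \<bar>f y - f (cut n y)\<bar> \<le> r / 3"
      using approx[of "r / 3"] by auto
    \<comment> \<open>Stated for general \<open>M\<close> to cover both the Gibbs measures and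
      \<open>P_inf\<close>: these two errors and the one from \<open>cyl\<close> are each allotted
      \<open>r / 3\<close>.\<close>
    have close: "\<bar>(\<integral>T. f (encode D T) \<partial>M) - (\<integral>T. f (cut n (encode D T)) \<partial>M)\<bar> \<le> r / 3"
      if "emeasure M (space M) \<le> 1" "encode D \<in> measurable M ?B" "space M \<subseteq> all_trees D" for M
      using that \<open>r > 0\<close>
      by (intro abs_integral_diff_le[where C = C] measurable_compose[OF _ f_B]
          measurable_compose[OF _ fcut_B] C n(2) cut_mem encode_mem_code_space) auto
    from LIMSEQ_D[OF cyl[OF n(1)], of "r / 3"] \<open>r > 0\<close> obtain N0 where N0: "\<And>N. N \<ge> N0 \<Longrightarrow>
      \<bar>(\<integral>T. f (cut n (encode D T)) \<partial>?\<mu> N) - (\<integral>T. f (cut n (encode D T)) \<partial>P_inf)\<bar> < r / 3"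
      by auto
    have "\<bar>(\<integral>T. f (encode D T) \<partial>?\<mu> N) - (\<integral>T. f (encode D T) \<partial>P_inf)\<bar> < r" if "N \<ge> N0" for N
    proof -
      have "\<bar>(\<integral>T. f (encode D T) \<partial>?\<mu> N) - (\<integral>T. f (cut n (encode D T)) \<partial>?\<mu> N)\<bar> \<le> r / 3"
        using trees by (intro close emeasure_gibbs_le enc_mu) (simp add: space_mu)
      moreover have
        "\<bar>(\<integral>T. f (encode D T) \<partial>P_inf) - (\<integral>T. f (cut n (encode D T)) \<partial>P_inf)\<bar> \<le> r / 3"
        using Q.emeasure_space_1 by (intro close enc_Q) (simp_all add: space_Q)
      ultimately show ?thesis
        using N0[OF that] by linarith
    qed
    then show "\<exists>N0. \<forall>N\<ge>N0. norm ((\<integral>T. f (encode D T) \<partial>?\<mu> N) - (\<integral>T. f (encode D T) \<partial>P_inf)) < r"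
      by auto
  qed
  then show "(\<lambda>N. integral\<^sup>L (on_codes D (?\<mu> N)) f) \<longlonglongrightarrow> integral\<^sup>L (on_codes D P_inf) f"
    by (simp add: on_codes_def integral_distr[OF enc_mu f_B] integral_distr[OF enc_Q f_B])
qed

end
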